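(* For every finite word $w$ on the positive integers, the orbit $\mathrm{Orb}(w)$ of $w$ under the parking quasi-symmetrizing action is exactly the set of words $w'$ with $\mathrm{Park}(w')=\mathrm{Park}(w)$. Consequently, for every parking function $u$, $$\mathbf{G}_u=\sum_{w\in\mathrm{Orb}(u)} w .$$ Moreover, an (infinite) formal linear combination of words on positive integers belongs to $\mathbf{PQSym}^*$ if and only if it is invariant under the parking quasi-symmetrizing action.
   Context: Words are finite words on $\mathbb{N}\setminus\{0\}$. A word $u=u_1\dots u_n$ is a parking function if its nondecreasing rearrangement $u'_1\le\dots\le u'_n$ satisfies $u'_i\le i$ for all $i$; it is a prime parking function if moreover $u'_i<i$ for all $2\le i\le n$ (the empty word is a prime parking function). Parkization: for $w=w_1\dots w_n$ let $d(w)=\min\{i\ge1:\ \#\{j: w_j\le i\}<i\}$; if $d(w)=n+1$ then $\mathrm{Park}(w)=w$, otherwise $\mathrm{Park}(w)=\mathrm{Park}(w')$ where $w'$ is obtained from $w$ by decreasing by one every letter greater than $d(w)$. For a parking function $u$, $\mathbf{G}_u=\sum_{w:\ \mathrm{Park}(w)=u} w$, and $\mathbf{PQSym}^*$ is the linear span over a field $\mathbb{K}$ of characteristic $0$ of the $\mathbf{G}_u$. Let $\mathrm{BW}$ be the set of infinite sequences of columns $(L_1,M_1),(L_2,M_2),\dots$ where each $L_i$ is a finite set of positive integers and each $M_i$ is a word, such that the nonempty $L_i$, in order, form a set composition (ordered set partition) of $[n]$ for some $n$ (the length), and each $M_i$ is a prime parking function of length $|L_i|$. A column with $L_i=\emptyset$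 (hence $M_i$ empty) is an empty column. Put $\|L\|=|L|$ if $L\ne\emptyset$ and $\|\emptyset\|=1$. Define $\Phi:\mathrm{BW}\to$ words by: for $m$ of length $n$, $\Phi(m)$ is the word $w$ of length $n$ such that, for each nonempty column $j$ and each $p\in L_j$ that is the $t$-th smallest element of $L_j$, $w_p$ equals the $t$-th letter of $M_j$ plus $\sum_{q<j}\|L_q\|$. $\Phi$ is a bijection, and words are identified with elements of $\mathrm{BW}$ through it. $\mathfrak{S}_\infty$ is generated by $s_i=(i,i+1)$, $i\ge1$. The parking quasi-symmetrizing action: $s_i$ acts on $m\in\mathrm{BW}$ by swapping the $i$-th and $(i+1)$-st columns if one of them is empty, and fixing $m$ otherwise; it is transported to words via $\Phi$ and extended linearly.
   Formalization: Since the sum of all words is invariant but not a finite combination of the G_u, the last claim is proved in two forms: for combinations of bounded degree with PQSym* the linear span, and for all formal combinations with PQSym* replaced by its completion (infinite combinations of the G_u). *)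

theory Defs
  imports
    Complex_Main
    "HOL-Combinatorics.Permutations"
    "HOL-Library.Disjoint_Sets"
    "HOL-Library.Function_Algebras"
begin

text \<open>Lists are 0-indexed: the letter \<open>w\<^sub>p\<close> of a word is \<open>w ! (p - 1)\<close>.\<close>

definition words :: "nat list set" where
  "words = {w. \<forall>a\<in>set w. 1 \<le> a}"

definition parking_function :: "nat list \<Rightarrow> bool" where
  "parking_function u \<longleftrightarrow>
     u \<in> words \<and> (\<forall>i\<in>{1..length u}. sort u ! (i - 1) \<le> i)"

definition prime_parking_function :: "nat list \<Rightarrow> bool" where
  "prime_parking_function u \<longleftrightarrow>
     parking_function u \<and> (\<forall>i\<in>{2..length u}. sort u ! (i - 1) < i)"


subsection \<open>Parkization\<close>

definition park_defect :: "nat list \<Rightarrow> nat" where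
  "park_defect w = (LEAST i. 1 \<le> i \<and> card {j. j < length w \<and> w ! j \<le> i} < i)"

definition park_step :: "nat list \<Rightarrow> nat list" where
  "park_step w = map (\<lambda>a. if park_defect w < a then a - 1 else a) w"

lemma park_defect_props:
  shows "1 \<le> park_defect w"
    and "card {j. j < length w \<and> w ! j \<le> park_defect w} < park_defect w"
    and "park_defect w \<le> length w + 1"
proof -
  let ?P = "\<lambda>i. 1 \<le> i \<and> card {j. j < length w \<and> w ! j \<le> i} < i"
  have "card {j. j < length w \<and> w ! j \<le> length w + 1} \<le> card {..<length w}"
    by (intro card_mono) auto
  then have P: "?P (length w + 1)"
    by simp
  show "1 \<le> park_defect w"
    and "card {j. j < length w \<and> w ! j \<le> park_defect w} < park_defect w"
    using LeastI[of ?P, OF P] by (simp_all add: park_defect_def)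
  show "park_defect w \<le> length w + 1"
    using Least_le[of ?P, OF P] by (simp add: park_defect_def)
qed

lemma sum_list_park_step:
  assumes "park_defect w \<noteq> length w + 1"
  shows "sum_list (park_step w) < sum_list w"
proof -
  let ?d = "park_defect w"
  have "\<exists>k<length w. ?d < w ! k"
  proof (rule ccontr)
    assume "\<not> ?thesis"
    then have "{j. j < length w \<and> w ! j \<le> ?d} = {..<length w}"
      by (fastforce simp: not_less)
    then show False
      using park_defect_props[of w] assms by simp
  qed
  then obtain k where k: "k < length w" "?d < w ! k"
    by blast
  have "(\<Sum>i<length w. park_step w ! i) < (\<Sum>i<length w. w ! i)"
    by (rule sum_strict_mono_ex1) (use k in \<open>auto simp: park_step_def intro!: bexI[of _ k]\<close>)
  then show ?thesis
    by (simp add: sum_list_sum_nth park_step_def lessThan_atLeast0)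
qed

function Park :: "nat list \<Rightarrow> nat list" where
  "Park w = (if park_defect w = length w + 1 then w else Park (park_step w))"
  by auto
termination
  by (relation "Wellfounded.measure sum_list") (use sum_list_park_step in auto)

declare Park.simps [simp del]


subsection \<open>Sequences of columns\<close>

text \<open>
  A sequence of columns is a function on \<open>nat\<close>; its value at \<open>i\<close> is the column numbered
  \<open>i + 1\<close> in the usual 1-based counting. The sets \<open>L\<^sub>i\<close> keep their 1-based elements.
\<close>

type_synonym columns = "nat \<Rightarrow> nat set \<times> nat list"

abbreviation col_set :: "columns \<Rightarrow> nat \<Rightarrow> nat set" where
  "col_set m i \<equiv> fst (m i)"

abbreviation col_word :: "columns \<Rightarrow> nat \<Rightarrow> nat list" where
  "col_word m i \<equiv> snd (m i)"

definition BW :: "columns set" where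
  "BW = {m. (\<exists>n. (\<Union>i. col_set m i) = {1..n}) \<and>
            disjoint_family (col_set m) \<and>
            (\<forall>i. prime_parking_function (col_word m i) \<and>
                 length (col_word m i) = card (col_set m i))}"

definition BW_length :: "columns \<Rightarrow> nat" where
  "BW_length m = card (\<Union>i. col_set m i)"

definition col_weight :: "nat set \<Rightarrow> nat" where
  "col_weight L = (if L = {} then 1 else card L)"

text \<open>
  If \<open>p\<close> is the \<open>t\<close>-th smallest element of its column set, then the number of smaller
  elements of that set is the 0-based index \<open>t - 1\<close>.
\<close>

definition BW_letter :: "columns \<Rightarrow> nat \<Rightarrow> nat" where
  "BW_letter m p =
     (let j = (THE j. p \<in> col_set m j) in
        col_word m j ! card {q \<in> col_set m j. q < p} + (\<Sum>q<j. col_weight (col_set m q)))"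

definition Phi :: "columns \<Rightarrow> nat list" where
  "Phi m = map (BW_letter m) [1..<BW_length m + 1]"


subsection \<open>The parking quasi-symmetrizing action\<close>

text \<open>
  The infinite symmetric group is the group of all finitely supported permutations of
  \<open>nat\<close> (the column indices), singled out by the predicate \<^const>\<open>permutation\<close>.
\<close>

definition simple_transposition :: "nat \<Rightarrow> nat \<Rightarrow> nat" where
  "simple_transposition i = transpose i (Suc i)"

definition generator_product :: "nat list \<Rightarrow> nat \<Rightarrow> nat" where
  "generator_product is = foldr (\<lambda>i \<sigma>. simple_transposition i \<circ> \<sigma>) is id"

definition swap_columns :: "nat \<Rightarrow> columns \<Rightarrow> columns" where
  "swap_columns i m =
     (if col_set m i = {} \<or> col_set m (Suc i) = {}
      then m(i := m (Suc i), Suc i := m i) else m)"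

text \<open>
  The action is prescribed on the generators and extended to a permutation through any
  factorization into generators; \<open>permutation_generated\<close> and
  \<open>BW_action_generator_product\<close> below show that a factorization exists and that the
  result does not depend on it.
\<close>

definition BW_action :: "(nat \<Rightarrow> nat) \<Rightarrow> columns \<Rightarrow> columns" where
  "BW_action \<sigma> m = foldr swap_columns (SOME is. generator_product is = \<sigma>) m"

definition word_action :: "(nat \<Rightarrow> nat) \<Rightarrow> nat list \<Rightarrow> nat list" where
  "word_action \<sigma> w = Phi (BW_action \<sigma> (inv_into BW Phi w))"

definition Orb :: "nat list \<Rightarrow> nat list set" where
  "Orb w = {word_action \<sigma> w | \<sigma>. permutation \<sigma>}"

lemma generator_product_simps [simp]:
  "generator_product [] = id"
  "generator_product (i # is) = simple_transposition i \<circ> generator_product is"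
  by (simp_all add: generator_product_def)

lemma generator_product_append:
  "generator_product (is @ js) = generator_product is \<circ> generator_product js"
  by (induction "is") (auto simp: comp_assoc)

lemma permutation_generator_product: "permutation (generator_product is)"
proof (induction "is")
  case (Cons i "is")
  then show ?case
    unfolding generator_product_simps simple_transposition_def
    by (intro permutation_compose permutation_swap_id)
qed simp

lemma transpose_generated: "\<exists>is. generator_product is = transpose a (a + Suc k)"
proof (induction k)
  case 0
  show ?case
    by (rule exI[of _ "[a]"]) (simp add: simple_transposition_def)
next
  case (Suc k)
  then obtain "is" where "is": "generator_product is = transpose a (a + Suc k)"
    by blast
  let ?b = "a + Suc k"
  have "generator_product ([?b] @ is @ [?b]) =
        transpose ?b (Suc ?b) \<circ> transpose a ?b \<circ> transpose ?b (Suc ?b)"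
    unfolding generator_product_append "is" by (simp add: simple_transposition_def comp_assoc)
  also have "\<dots> = transpose a (a + Suc (Suc k))"
    by (auto simp: fun_eq_iff transpose_def)
  finally show ?case
    by blast
qed

lemma permutation_generated:
  assumes "permutation \<sigma>"
  shows "\<exists>is. generator_product is = \<sigma>"
proof -
  from assms obtain n where "swapidseq n \<sigma>"
    by (auto simp: permutation_def)
  then show ?thesis
  proof (induction rule: swapidseq.induct)
    case id
    show ?case
      by (rule exI[of _ "[]"]) simp
  next
    case (comp_Suc n p a b)
    then obtain "is" where "is": "generator_product is = p"
      by blast
    have "\<exists>js. generator_product js = transpose c d" if "c < d" for c d
      using transpose_generated[of c "d - c - 1"] that by simp
    then obtain js where "generator_product js = transpose a b"
      using comp_Suc.hyps by (metis linorder_neqE_nat transpose_commute)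
    with "is" have "generator_product (js @ is) = transpose a b \<circ> p"
      by (simp add: generator_product_append)
    then show ?case
      by blast
  qed
qed

text \<open>
  \<open>placed_at J C m\<close>: the nonempty columns of \<open>m\<close> are \<open>C 0, C 1, \<dots>\<close>, sitting in this order at
  the positions in \<open>J\<close>. A permutation \<open>\<sigma>\<close> keeps \<open>C\<close> and replaces \<open>J\<close> by \<open>\<sigma> ` J\<close>, so the action
  depends on \<open>\<sigma>\<close> only.
\<close>

definition placed_at :: "nat set \<Rightarrow> columns \<Rightarrow> columns \<Rightarrow> bool" where
  "placed_at J C m \<longleftrightarrow>
     (\<forall>i. m i = (if i \<in> J then C (card (J \<inter> {..<i})) else ({}, []))) \<and>
     (\<forall>i. col_set m i \<noteq> {} \<longleftrightarrow> i \<in> J)"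

lemma card_transpose_image:
  fixes J :: "nat set"
  assumes "k \<noteq> Suc i"
  shows "card ((simple_transposition i ` J) \<inter> {..<k}) = card (J \<inter> {..<k})"
proof -
  have "(simple_transposition i ` J) \<inter> {..<k} = simple_transposition i ` (J \<inter> {..<k})"
    using assms by (auto simp: simple_transposition_def transpose_def image_iff split: if_splits)
  then show ?thesis
    by (simp add: simple_transposition_def card_image)
qed

lemma mem_transpose_image:
  "k \<in> simple_transposition i ` J \<longleftrightarrow> simple_transposition i k \<in> J"
  by (auto simp: simple_transposition_def image_iff) (metis transpose_involutory)

lemma placed_at_swap_columns:
  assumes "placed_at J C m"
  shows "placed_at (simple_transposition i ` J) C (swap_columns i m)"
proof -
  let ?J = "simple_transposition i ` J"
  have m: "m k = (if k \<in> J then C (card (J \<inter> {..<k})) else ({}, []))"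
    and ne: "col_set m k \<noteq> {} \<longleftrightarrow> k \<in> J" for k
    using assms[unfolded placed_at_def, THEN conjunct1, rule_format]
      assms[unfolded placed_at_def, THEN conjunct2, rule_format] by - (assumption+)
  show ?thesis
  proof (cases "i \<in> J \<and> Suc i \<in> J")
    case True
    have "k \<in> ?J \<longleftrightarrow> k \<in> J" for k
      unfolding mem_transpose_image using True
      by (auto simp: simple_transposition_def transpose_def)
    then have "?J = J"
      by blast
    moreover have "swap_columns i m = m"
      using True ne[of i] ne[of "Suc i"] by (simp add: swap_columns_def)
    ultimately show ?thesis
      using assms by simp
  next
    case False
    have sw: "swap_columns i m k = m (simple_transposition i k)" for k
    proof -
      have "col_set m i = {} \<or> col_set m (Suc i) = {}"
        using False ne[of i] ne[of "Suc i"] by blast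
      then show ?thesis
        by (simp add: swap_columns_def simple_transposition_def transpose_def)
    qed
    have S: "A \<inter> {..<Suc i} = (if i \<in> A then insert i (A \<inter> {..<i}) else A \<inter> {..<i})" for A
      by (auto simp: less_Suc_eq)
    have J': "i \<in> ?J \<longleftrightarrow> Suc i \<in> J" "Suc i \<in> ?J \<longleftrightarrow> i \<in> J"
      unfolding mem_transpose_image by (simp_all add: simple_transposition_def)
    have st: "simple_transposition i k = k" if "k \<noteq> i" "k \<noteq> Suc i" for k
      using that by (simp add: simple_transposition_def)
    have st1: "simple_transposition i i = Suc i" "simple_transposition i (Suc i) = i"
      by (simp_all add: simple_transposition_def)
    have c: "card (?J \<inter> {..<k}) = card (J \<inter> {..<simple_transposition i k})"
      if "k \<in> ?J" for k
    proof -
      consider "k = i" | "k = Suc i" | "k \<noteq> i" "k \<noteq> Suc i"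
        by blast
      then show ?thesis
      proof cases
        case 1
        then have "i \<notin> J"
          using that J' False by auto
        with 1 show ?thesis
          using card_transpose_image[of i i J] by (simp add: st1 S)
      next
        case 2
        then have "i \<notin> ?J"
          using that J' False by auto
        with 2 show ?thesis
          using card_transpose_image[of i i J]
          by (simp add: st1 S)
      next
        case 3
        then show ?thesis
          using card_transpose_image[of k i J] by (simp add: st)
      qed
    qed
    show ?thesis
      unfolding placed_at_def sw
    proof (intro conjI allI)
      fix k
      show "col_set m (simple_transposition i k) \<noteq> {} \<longleftrightarrow> k \<in> ?J"
        by (simp only: ne mem_transpose_image)
      show "m (simple_transposition i k) = (if k \<in> ?J then C (card (?J \<inter> {..<k})) else ({}, []))"
      proof (cases "k \<in> ?J")
        case True
        then show ?thesis
          by (simp only: c m[of "simple_transposition i k"] mem_transpose_image[symmetric] if_True)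
      next
        case False
        then show ?thesis
          by (simp only: m[of "simple_transposition i k"] mem_transpose_image[symmetric] if_False)
      qed
    qed
  qed
qed

lemma placed_at_foldr:
  "placed_at J C m \<Longrightarrow> placed_at (generator_product is ` J) C (foldr swap_columns is m)"
proof (induction "is")
  case (Cons i "is")
  then show ?case
    using placed_at_swap_columns[of "generator_product is ` J" C "foldr swap_columns is m" i]
    by (simp add: image_comp)
qed simp

lemma placed_at_unique: "placed_at J C m \<Longrightarrow> placed_at J C m' \<Longrightarrow> m = m'"
  unfolding placed_at_def fun_eq_iff by presburger

lemma BW_placed_at:
  assumes "m \<in> BW"
  shows "\<exists>J C. placed_at J C m"
proof -
  define J where "J = {i. col_set m i \<noteq> {}}"
  define C where "C t = m (THE i. i \<in> J \<and> card (J \<inter> {..<i}) = t)" for t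
  have mono: "card (J \<inter> {..<i}) < card (J \<inter> {..<k})" if "i \<in> J" "i < k" for i k
    by (rule psubset_card_mono) (use that in auto)
  have C: "C (card (J \<inter> {..<i})) = m i" if "i \<in> J" for i
  proof -
    have "(THE k. k \<in> J \<and> card (J \<inter> {..<k}) = card (J \<inter> {..<i})) = i"
      using that mono by (intro the_equality) (auto, metis less_irrefl linorder_neqE_nat)
    then show ?thesis
      by (simp add: C_def)
  qed
  have "m i = ({}, [])" if "i \<notin> J" for i
  proof -
    have "col_set m i = {}" and "length (col_word m i) = card (col_set m i)"
      using that assms by (auto simp: J_def BW_def)
    then show ?thesis
      by (simp add: prod_eq_iff)
  qed
  with C have "m i = (if i \<in> J then C (card (J \<inter> {..<i})) else ({}, []))" for i
    by presburger
  moreover have "col_set m i \<noteq> {} \<longleftrightarrow> i \<in> J" for i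
    by (simp add: J_def)
  ultimately have "placed_at J C m"
    unfolding placed_at_def by blast
  then show ?thesis
    by blast
qed

lemma BW_action_generator_product:
  assumes "m \<in> BW"
  shows "BW_action (generator_product is) m = foldr swap_columns is m"
proof -
  obtain J C where p: "placed_at J C m"
    using BW_placed_at[OF assms] by blast
  define js where "js = (SOME js. generator_product js = generator_product is)"
  have js: "generator_product js = generator_product is"
    unfolding js_def by (rule someI[of _ "is"]) (rule refl)
  show ?thesis
    using placed_at_unique[OF placed_at_foldr[OF p, of js, unfolded js] placed_at_foldr[OF p]]
    by (simp add: BW_action_def js_def)
qed


subsection \<open>Formal linear combinations of words\<close>

text \<open>
  A possibly infinite formal linear combination of words is given by its coefficient
  function, which vanishes on the lists that are not words.
\<close>

definition word_series :: "(nat list \<Rightarrow> 'k::field_char_0) set" where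
  "word_series = {f. \<forall>w. w \<notin> words \<longrightarrow> f w = 0}"

definition bounded_degree :: "(nat list \<Rightarrow> 'k::field_char_0) \<Rightarrow> bool" where
  "bounded_degree f \<longleftrightarrow> (\<exists>N. \<forall>w. f w \<noteq> 0 \<longrightarrow> length w \<le> N)"

text \<open>The formal sum of the elements of a set of words.\<close>

definition formal_sum :: "nat list set \<Rightarrow> nat list \<Rightarrow> 'k::field_char_0" where
  "formal_sum A = (\<lambda>w. of_bool (w \<in> A))"

definition G :: "nat list \<Rightarrow> nat list \<Rightarrow> 'k::field_char_0" where
  "G u = formal_sum {w \<in> words. Park w = u}"

definition series_scale :: "'k::field_char_0 \<Rightarrow> (nat list \<Rightarrow> 'k) \<Rightarrow> nat list \<Rightarrow> 'k" where
  "series_scale c f = (\<lambda>w. c * f w)"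

global_interpretation series: vector_space series_scale
  by unfold_locales (auto simp: series_scale_def fun_eq_iff algebra_simps)

definition PQSym_dual :: "(nat list \<Rightarrow> 'k::field_char_0) set" where
  "PQSym_dual = series.span {G u | u. parking_function u}"

text \<open>
  The degree completion: arbitrary infinite linear combinations of the \<^const>\<open>G\<close> series.
  They make sense because every word occurs in only one of them.
\<close>

definition PQSym_dual_completed :: "(nat list \<Rightarrow> 'k::field_char_0) set" where
  "PQSym_dual_completed =
     {f. \<exists>c. \<forall>w. f w = (\<Sum>u | parking_function u \<and> G u w \<noteq> (0::'k). c u * G u w)}"

text \<open>
  Linear extension of the action: the coefficient of \<open>v\<close> in \<open>\<Sum>w. f w \<cdot> \<sigma>(w)\<close> collects the
  coefficients of all \<open>w\<close> that \<open>\<sigma>\<close> maps to \<open>v\<close>.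
\<close>

definition series_action ::
    "(nat \<Rightarrow> nat) \<Rightarrow> (nat list \<Rightarrow> 'k::field_char_0) \<Rightarrow> nat list \<Rightarrow> 'k" where
  "series_action \<sigma> f = (\<lambda>v. \<Sum>w | w \<in> words \<and> word_action \<sigma> w = v. f w)"

definition parking_invariant :: "(nat list \<Rightarrow> 'k::field_char_0) \<Rightarrow> bool" where
  "parking_invariant f \<longleftrightarrow> (\<forall>\<sigma>. permutation \<sigma> \<longrightarrow> series_action \<sigma> f = f)"

end

theory Submission
  imports Defs
begin

text \<open>
  The columns of a word can be read off greedily. If \<open>s\<close> is the total weight of the columns found
  so far, the next one has weight \<open>k\<close>, the least \<open>k \<ge> 1\<close> such that at most \<open>k\<close> letters lie in
  \<open>(s, s + k]\<close>; minimality of \<open>k\<close> makes the word of the column a prime parking function or empty.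
  This inverts \<^const>\<open>Phi\<close>. The defect of a word is the value \<open>s + 1\<close> belonging to its first empty
  column, so a parkization step deletes that column, and parkization pushes all nonempty columns
  to the left. Hence two words have the same parkization iff they have the same sequence of
  nonempty columns, and by definition of the action this means that they lie in the same orbit.
\<close>

subsection \<open>Counting small letters\<close>

text \<open>This count replaces the sorted rearrangement: the defect and the parking conditions both
  become inequalities for it.\<close>

definition letters_le :: "nat list \<Rightarrow> nat \<Rightarrow> nat" where
  "letters_le w a = length (filter (\<lambda>x. x \<le> a) w)"

lemma card_letters_le: "card {j. j < length w \<and> w ! j \<le> a} = letters_le w a"
  by (simp add: letters_le_def length_filter_conv_card)

lemma letters_le_map:
  assumes "distinct xs"
  shows "letters_le (map f xs) a = card {x \<in> set xs. f x \<le> a}"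
  using distinct_card[OF distinct_filter[OF assms, of "\<lambda>x. f x \<le> a"]]
  by (simp add: letters_le_def filter_map comp_def)

text \<open>In a sorted list the entries at most \<open>a\<close> form an initial segment, and
  \<open>letters_le xs a\<close> is its length.\<close>

lemma sorted_nth_le_iff:
  "sorted xs \<Longrightarrow> i < length xs \<Longrightarrow> xs ! i \<le> a \<longleftrightarrow> i < letters_le xs a"
proof (induction xs arbitrary: i)
  case (Cons x xs)
  show ?case
  proof (cases "x \<le> a")
    case True
    then show ?thesis
      using Cons by (cases i) (auto simp: letters_le_def)
  next
    case False
    then have "filter (\<lambda>y. y \<le> a) xs = []"
      using Cons.prems by (auto simp: filter_empty_conv)
    moreover have "x \<le> (x # xs) ! i"
      using Cons.prems by (cases i) auto
    ultimately show ?thesis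
      using False by (auto simp: letters_le_def)
  qed
qed simp

lemma sort_nth_le_iff:
  fixes u :: "nat list"
  assumes "i < length u"
  shows "sort u ! i \<le> a \<longleftrightarrow> i < letters_le u a"
proof -
  have "letters_le (sort u) a = letters_le u a"
    unfolding letters_le_def by (metis mset_filter mset_sort size_mset)
  then show ?thesis
    using sorted_nth_le_iff[of "sort u" i a] assms by simp
qed

lemma letters_le_eq_length_iff: "letters_le u a = length u \<longleftrightarrow> (\<forall>x\<in>set u. x \<le> a)"
  unfolding letters_le_def
  by (metis filter_True length_filter_less nat_neq_iff)

lemma letters_le_le_length: "letters_le u a \<le> length u"
  by (simp add: letters_le_def)

lemma parking_function_iff:
  "parking_function u \<longleftrightarrow> u \<in> words \<and> (\<forall>i\<in>{1..length u}. i \<le> letters_le u i)"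
proof -
  have "sort u ! (i - 1) \<le> i \<longleftrightarrow> i \<le> letters_le u i" if "i \<in> {1..length u}" for i
  proof -
    have "i - 1 < length u" "i - 1 < letters_le u i \<longleftrightarrow> i \<le> letters_le u i"
      using that by auto
    then show ?thesis
      using sort_nth_le_iff[of "i - 1" u i] by simp
  qed
  then show ?thesis
    by (auto simp: parking_function_def)
qed

text \<open>Strictness of the prime condition at \<open>i + 1\<close> says that more than
  \<open>i\<close> letters are at most \<open>i\<close>. Of the parking condition only the case
  \<open>i = length u\<close> then remains, which bounds all letters by the length.\<close>

lemma prime_parking_function_iff:
  "prime_parking_function u \<longleftrightarrow>
     u \<in> words \<and> (\<forall>i. 1 \<le> i \<and> i < length u \<longrightarrow> i < letters_le u i) \<and> (\<forall>a\<in>set u. a \<le> length u)"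
  (is "?L \<longleftrightarrow> ?w \<and> ?A \<and> ?B")
proof -
  have *: "sort u ! (i - 1) < i \<longleftrightarrow> i - 1 < letters_le u (i - 1)" if "i \<in> {2..length u}" for i
  proof -
    have "i - 1 < length u" "sort u ! (i - 1) < i \<longleftrightarrow> sort u ! (i - 1) \<le> i - 1"
      using that by auto
    then show ?thesis
      using sort_nth_le_iff[of "i - 1" u "i - 1"] by simp
  qed
  show ?thesis
  proof
    assume L: ?L
    have ?A
    proof (intro allI impI)
      fix i assume "1 \<le> i \<and> i < length u"
      then have i: "Suc i \<in> {2..length u}"
        by auto
      then have "sort u ! (Suc i - 1) < Suc i"
        using L by (simp only: prime_parking_function_def)
      then show "i < letters_le u i"
        using *[OF i] by simp
    qed
    moreover have ?B
    proof (cases "u = []")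
      case False
      then have "1 \<le> length u"
        by (simp add: Suc_le_eq)
      then have "length u \<le> letters_le u (length u)"
        using L by (auto simp: prime_parking_function_def parking_function_iff)
      then show ?thesis
        using letters_le_eq_length_iff[of u "length u"] letters_le_le_length[of u "length u"] by auto
    qed simp
    ultimately show "?w \<and> ?A \<and> ?B"
      using L by (auto simp: prime_parking_function_def parking_function_iff)
  next
    assume R: "?w \<and> ?A \<and> ?B"
    then have "letters_le u (length u) = length u"
      by (simp add: letters_le_eq_length_iff)
    then have "i \<le> letters_le u i" if "i \<in> {1..length u}" for i
      using that R by (cases "i = length u") (auto simp: less_imp_le)
    moreover have "sort u ! (i - 1) < i" if "i \<in> {2..length u}" for i
    proof -
      have "1 \<le> i - 1 \<and> i - 1 < length u"
        using that by auto
      with R show ?thesis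
        unfolding *[OF that] by blast
    qed
    ultimately show ?L
      using R by (simp add: prime_parking_function_def parking_function_iff)
  qed
qed

text \<open>Used with offsets for \<open>f\<close> to find the interval, hence the column, that
  contains the value \<open>a\<close>. In the induction step either \<open>a\<close> is at most
  \<open>f j\<close> or \<open>j\<close> itself is the index.\<close>

lemma between_consecutive:
  fixes f :: "nat \<Rightarrow> nat"
  shows "f 0 < a \<Longrightarrow> a \<le> f j \<Longrightarrow> \<exists>i<j. f i < a \<and> a \<le> f (Suc i)"
proof (induction j)
  case (Suc j)
  then show ?case
    by (cases "a \<le> f j") (auto simp: less_Suc_eq)
qed simp

subsection \<open>Columns of a word\<close>

text \<open>Ranks increase strictly along \<open>L\<close>, so they are injective into
  \<open>{..<card L}\<close>, and equality of cardinalities gives surjectivity.\<close>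

lemma rank_bij_betw:
  fixes L :: "nat set"
  assumes "finite L"
  shows "bij_betw (\<lambda>p. card {q \<in> L. q < p}) L {..<card L}"
proof -
  have less: "card {q \<in> L. q < p} < card {q \<in> L. q < p'}" if "p \<in> L" "p < p'" for p p'
    by (rule psubset_card_mono) (use assms that in auto)
  have inj: "inj_on (\<lambda>p. card {q \<in> L. q < p}) L"
  proof (rule inj_onI)
    fix p p'
    assume "p \<in> L" "p' \<in> L" "card {q \<in> L. q < p} = card {q \<in> L. q < p'}"
    then show "p = p'"
      using less[of p p'] less[of p' p] by (cases p p' rule: linorder_cases) simp_all
  qed
  moreover have "(\<lambda>p. card {q \<in> L. q < p}) ` L \<subseteq> {..<card L}"
    using assms by (auto intro!: psubset_card_mono)
  ultimately have "(\<lambda>p. card {q \<in> L. q < p}) ` L = {..<card L}"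
    by (intro card_subset_eq) (simp_all add: card_image)
  with inj show ?thesis
    by (simp add: bij_betw_def)
qed

lemma rank_sorted_list_of_set:
  fixes L :: "nat set"
  assumes "finite L" "t < card L"
  shows "card {q \<in> L. q < sorted_list_of_set L ! t} = t"
proof -
  let ?xs = "sorted_list_of_set L"
  have len: "length ?xs = card L" and L: "set ?xs = L"
    using assms by simp_all
  have nth_less: "?xs ! i < ?xs ! k" if "i < k" "k < card L" for i k
    using strict_sorted_list_of_set[of L] that len by (auto simp: sorted_wrt_iff_nth_less)
  have "{q \<in> L. q < ?xs ! t} = (!) ?xs ` {..<t}"
    (is "?A = ?B")
  proof (intro set_eqI iffI)
    fix q assume q: "q \<in> ?A"
    then obtain i where "i < card L" "q = ?xs ! i"
      using L len by (metis (no_types, lifting) in_set_conv_nth mem_Collect_eq)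
    with q nth_less[of t i] show "q \<in> ?B"
      by (cases i t rule: linorder_cases) auto
  next
    fix q assume "q \<in> ?B"
    then obtain i where "i < t" "q = ?xs ! i"
      by blast
    then show "q \<in> ?A"
      using nth_less[of i t] assms(2) len L nth_mem[of i ?xs] by auto
  qed
  moreover have "inj_on ((!) ?xs) {..<t}"
    using assms(2) len by (intro inj_on_nth) auto
  ultimately show ?thesis
    by (simp add: card_image)
qed

text \<open>The shift that \<open>Phi\<close> adds to the word of column \<open>j\<close>. The
  letters of that column lie between this offset, excluded, and the next one, included.\<close>

definition col_offset :: "columns \<Rightarrow> nat \<Rightarrow> nat" where
  "col_offset m j = (\<Sum>q<j. col_weight (col_set m q))"

lemma col_offset_0 [simp]: "col_offset m 0 = 0"
  and col_offset_Suc: "col_offset m (Suc j) = col_offset m j + col_weight (col_set m j)"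
  by (simp_all add: col_offset_def)

section \<open>Letters and columns of \<open>Phi m\<close>\<close>

context
  fixes m assumes m: "m \<in> BW"
begin

lemma Union_col_set: "(\<Union>i. col_set m i) = {1..BW_length m}"
proof -
  obtain n where "(\<Union>i. col_set m i) = {1..n}"
    using m by (auto simp: BW_def)
  then show ?thesis
    by (simp add: BW_length_def)
qed

lemma col_set_subset: "col_set m j \<subseteq> {1..BW_length m}"
  using Union_col_set by blast

lemma finite_col_set: "finite (col_set m j)"
  using finite_subset[OF col_set_subset] by simp

lemma prime_col_word: "prime_parking_function (col_word m j)"
  and length_col_word: "length (col_word m j) = card (col_set m j)"
  using m by (auto simp: BW_def)

lemma col_set_unique: "p \<in> col_set m i \<Longrightarrow> p \<in> col_set m j \<Longrightarrow> i = j"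
  using m by (auto simp: BW_def disjoint_family_on_def)

lemma col_set_cover: "p \<in> {1..BW_length m} \<Longrightarrow> \<exists>j. p \<in> col_set m j"
  using Union_col_set by blast

lemma empty_col: "col_set m j = {} \<Longrightarrow> m j = ({}, [])"
  using length_col_word[of j] by (auto simp: prod_eq_iff)

lemma col_weight_pos: "0 < col_weight (col_set m j)"
  using finite_col_set by (simp add: col_weight_def card_gt_0_iff)

lemma strict_mono_col_offset: "strict_mono (col_offset m)"
  using col_weight_pos by (simp add: strict_mono_Suc_iff col_offset_Suc)

lemma length_Phi: "length (Phi m) = BW_length m"
  by (simp add: Phi_def)

lemma Phi_nth: "p \<in> {1..BW_length m} \<Longrightarrow> Phi m ! (p - 1) = BW_letter m p"
  by (auto simp: Phi_def simp del: upt_Suc)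

lemma BW_letter_eq:
  assumes "p \<in> col_set m j"
  shows "BW_letter m p = col_word m j ! card {q \<in> col_set m j. q < p} + col_offset m j"
proof -
  have "(THE j. p \<in> col_set m j) = j"
    using assms col_set_unique by blast
  then show ?thesis
    by (simp add: BW_letter_def col_offset_def)
qed

lemma rank_less: "p \<in> col_set m j \<Longrightarrow> card {q \<in> col_set m j. q < p} < length (col_word m j)"
  using bij_betwE[OF rank_bij_betw[OF finite_col_set]] by (simp add: length_col_word)

text \<open>Letters of a prime parking function lie between 1 and its length, and for a nonempty
  column that length is the weight.\<close>

lemma BW_letter_bounds:
  assumes "p \<in> col_set m j"
  shows "col_offset m j < BW_letter m p" "BW_letter m p \<le> col_offset m (Suc j)"
proof -
  let ?x = "col_word m j ! card {q \<in> col_set m j. q < p}"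
  have "?x \<in> set (col_word m j)"
    using rank_less[OF assms] by simp
  then have "1 \<le> ?x" "?x \<le> card (col_set m j)"
    using prime_col_word[of j] length_col_word[of j]
    by (auto simp: prime_parking_function_iff words_def)
  then show "col_offset m j < BW_letter m p" "BW_letter m p \<le> col_offset m (Suc j)"
    using assms by (auto simp: BW_letter_eq[OF assms] col_offset_Suc col_weight_def)
qed

text \<open>The intervals between consecutive offsets are disjoint, so the value of a letter
  determines its column.\<close>

lemma mem_col_set_iff:
  assumes "p \<in> {1..BW_length m}"
  shows "p \<in> col_set m j \<longleftrightarrow> col_offset m j < BW_letter m p \<and> BW_letter m p \<le> col_offset m (Suc j)"
proof
  assume *: "col_offset m j < BW_letter m p \<and> BW_letter m p \<le> col_offset m (Suc j)"
  obtain i where i: "p \<in> col_set m i"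
    using col_set_cover[OF assms] by blast
  have "col_offset m j < col_offset m (Suc i)" "col_offset m i < col_offset m (Suc j)"
    using * BW_letter_bounds[OF i] by linarith+
  then have "i = j"
    by (auto simp: strict_mono_less[OF strict_mono_col_offset])
  with i show "p \<in> col_set m j"
    by simp
qed (use BW_letter_bounds in blast)

lemma Phi_in_words: "Phi m \<in> words"
proof -
  have "1 \<le> BW_letter m p" if "p \<in> {1..BW_length m}" for p
    using col_set_cover[OF that] BW_letter_bounds by fastforce
  then show ?thesis
    by (auto simp: words_def Phi_def simp del: upt_Suc)
qed

lemma letters_le_Phi: "letters_le (Phi m) a = card {p \<in> {1..BW_length m}. BW_letter m p \<le> a}"
  unfolding Phi_def
  by (subst letters_le_map) (auto intro!: arg_cong[of _ _ card] simp del: upt_Suc)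

text \<open>The rank maps the column bijectively onto the indices of its word and matches shifted
  letters with letters of the word.\<close>

lemma letters_le_col_word:
  "letters_le (col_word m j) k = card {p \<in> col_set m j. BW_letter m p \<le> col_offset m j + k}"
proof -
  let ?r = "\<lambda>p. card {q \<in> col_set m j. q < p}"
  have r: "bij_betw ?r (col_set m j) {..<card (col_set m j)}"
    by (rule rank_bij_betw[OF finite_col_set])
  have image: "?r ` {p \<in> col_set m j. BW_letter m p \<le> col_offset m j + k} =
      {t. t < card (col_set m j) \<and> col_word m j ! t \<le> k}" (is "?r ` ?A = ?B")
  proof (intro set_eqI iffI)
    fix t assume "t \<in> ?r ` ?A"
    then show "t \<in> ?B"
      using rank_less[of _ j] by (auto simp: BW_letter_eq length_col_word)
  next
    fix t assume t: "t \<in> ?B"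
    then obtain p where "p \<in> col_set m j" "t = ?r p"
      using r by (auto simp: bij_betw_def image_iff set_eq_iff)
    with t show "t \<in> ?r ` ?A"
      by (auto simp: BW_letter_eq)
  qed
  have "inj_on ?r ?A"
    using r by (auto simp: bij_betw_def intro: inj_on_subset)
  from card_image[OF this] show ?thesis
    unfolding image card_letters_le[symmetric] length_col_word .
qed

text \<open>As \<open>k\<close> is at most the weight, the letters above
  \<open>col_offset m j\<close> and at most \<open>col_offset m j + k\<close> all belong to column
  \<open>j\<close>.\<close>

lemma letters_le_Phi_offset:
  assumes "k \<le> col_weight (col_set m j)"
  shows "letters_le (Phi m) (col_offset m j + k) =
    letters_le (Phi m) (col_offset m j) + letters_le (col_word m j) k"
proof -
  let ?A = "{p \<in> {1..BW_length m}. BW_letter m p \<le> col_offset m j}"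
  let ?B = "{p \<in> col_set m j. BW_letter m p \<le> col_offset m j + k}"
  have "{p \<in> {1..BW_length m}. BW_letter m p \<le> col_offset m j + k} = ?A \<union> ?B"
    using assms mem_col_set_iff[of _ j] col_set_subset[of j] by (auto simp: col_offset_Suc)
  moreover have "?A \<inter> ?B = {}"
    using BW_letter_bounds(1)[of _ j] by fastforce
  ultimately show ?thesis
    unfolding letters_le_Phi letters_le_col_word using finite_col_set by (simp add: card_Un_disjoint)
qed

end

section \<open>Greedy reconstruction of the columns\<close>

definition next_offset :: "nat list \<Rightarrow> nat \<Rightarrow> nat" where
  "next_offset w s = s + (LEAST k. 1 \<le> k \<and> letters_le w (s + k) \<le> letters_le w s + k)"

definition word_offset :: "nat list \<Rightarrow> nat \<Rightarrow> nat" where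
  "word_offset w j = (next_offset w ^^ j) 0"

definition word_block :: "nat list \<Rightarrow> nat \<Rightarrow> nat set" where
  "word_block w j =
     {p \<in> {1..length w}. word_offset w j < w ! (p - 1) \<and> w ! (p - 1) \<le> word_offset w (Suc j)}"

text \<open>The inverse of \<open>Phi\<close> on words. Listing the block in increasing order puts
  the letter at its \<open>t\<close>-th smallest position at place \<open>t\<close>, and subtracting
  the offset undoes the shift.\<close>

definition columns_of :: "nat list \<Rightarrow> columns" where
  "columns_of w j = (word_block w j,
     map (\<lambda>p. w ! (p - 1) - word_offset w j) (sorted_list_of_set (word_block w j)))"

text \<open>The greedy step from \<open>col_offset m j\<close> advances by the column weight: the
  column has no more letters than its weight, so the bound holds there, and primality rules out
  every smaller positive \<open>k\<close>.\<close>

lemma word_offset_Phi: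
  assumes m: "m \<in> BW"
  shows "word_offset (Phi m) j = col_offset m j"
proof (induction j)
  case (Suc j)
  let ?s = "col_offset m j" and ?W = "col_weight (col_set m j)" and ?u = "col_word m j"
  note ppf = prime_col_word[OF m, of j, unfolded prime_parking_function_iff]
  have "(LEAST k. 1 \<le> k \<and> letters_le (Phi m) (?s + k) \<le> letters_le (Phi m) ?s + k) = ?W"
  proof (rule Least_equality)
    have "letters_le ?u ?W \<le> ?W"
      using letters_le_le_length[of ?u ?W] by (simp add: length_col_word[OF m] col_weight_def split: if_splits)
    then show "1 \<le> ?W \<and> letters_le (Phi m) (?s + ?W) \<le> letters_le (Phi m) ?s + ?W"
      using col_weight_pos[OF m, of j] by (simp add: letters_le_Phi_offset[OF m])
  next
    fix k assume k: "1 \<le> k \<and> letters_le (Phi m) (?s + k) \<le> letters_le (Phi m) ?s + k"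
    show "?W \<le> k"
    proof (rule ccontr)
      assume "\<not> ?W \<le> k"
      then have "k < ?W" by simp
      then have "k < length ?u"
        using k by (auto simp: length_col_word[OF m] col_weight_def split: if_splits)
      then have "k < letters_le ?u k"
        using ppf k by blast
      then show False
        using k \<open>k < ?W\<close> by (simp add: letters_le_Phi_offset[OF m])
    qed
  qed
  with Suc show ?case
    by (simp add: word_offset_def next_offset_def col_offset_Suc)
qed (simp add: word_offset_def)

text \<open>Equal offsets give equal blocks by \<open>mem_col_set_iff\<close>; the words agree
  because the entry of index \<open>t\<close> in the sorted list of a block has rank
  \<open>t\<close>.\<close>

lemma columns_of_Phi:
  assumes m: "m \<in> BW"
  shows "columns_of (Phi m) = m"
proof
  fix j
  have B: "word_block (Phi m) j = col_set m j"
  proof (intro set_eqI)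
    fix p
    show "p \<in> word_block (Phi m) j \<longleftrightarrow> p \<in> col_set m j"
    proof (cases "p \<in> {1..BW_length m}")
      case True
      then show ?thesis
        unfolding mem_col_set_iff[OF m True] Phi_nth[OF m True, symmetric]
        by (simp add: word_block_def word_offset_Phi[OF m] length_Phi[OF m])
    next
      case False
      then show ?thesis
        using col_set_subset[OF m, of j] by (auto simp: word_block_def length_Phi[OF m])
    qed
  qed
  let ?xs = "sorted_list_of_set (col_set m j)"
  have "map (\<lambda>p. Phi m ! (p - 1) - col_offset m j) ?xs = col_word m j"
  proof (rule nth_equalityI)
    fix t assume "t < length (map (\<lambda>p. Phi m ! (p - 1) - col_offset m j) ?xs)"
    then have t: "t < card (col_set m j)"
      by simp
    then have p: "?xs ! t \<in> col_set m j"
      using finite_col_set[OF m, of j] by (metis length_sorted_list_of_set nth_mem set_sorted_list_of_set)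
    then have "Phi m ! (?xs ! t - 1) = BW_letter m (?xs ! t)"
      using col_set_subset[OF m, of j] by (intro Phi_nth[OF m]) blast
    also have "\<dots> = col_word m j ! t + col_offset m j"
      unfolding BW_letter_eq[OF m p] rank_sorted_list_of_set[OF finite_col_set[OF m] t] ..
    finally show "map (\<lambda>p. Phi m ! (p - 1) - col_offset m j) ?xs ! t = col_word m j ! t"
      using t by simp
  qed (simp add: length_col_word[OF m])
  then show "columns_of (Phi m) j = m j"
    by (simp add: columns_of_def B word_offset_Phi[OF m])
qed

context
  fixes w :: "nat list"
begin

lemma next_offset_props:
  obtains k where "next_offset w s = s + k" "1 \<le> k" "letters_le w (s + k) \<le> letters_le w s + k"
    "\<And>i. 1 \<le> i \<Longrightarrow> i < k \<Longrightarrow> letters_le w s + i < letters_le w (s + i)"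
proof
  let ?P = "\<lambda>k. 1 \<le> k \<and> letters_le w (s + k) \<le> letters_le w s + k"
  \<comment> \<open>No interval contains more than \<open>length w\<close> letters, so this value is
    a candidate for \<open>k\<close>.\<close>
  have "?P (Suc (length w))"
    using letters_le_le_length[of w "s + Suc (length w)"] by simp
  then have "?P (Least ?P)"
    by (rule LeastI)
  then show "1 \<le> Least ?P" "letters_le w (s + Least ?P) \<le> letters_le w s + Least ?P"
    by blast+
  show "letters_le w s + i < letters_le w (s + i)" if "1 \<le> i" "i < Least ?P" for i
    using not_less_Least[OF that(2)] that(1) by simp
qed (simp add: next_offset_def)

lemma word_offset_Suc: "word_offset w (Suc j) = next_offset w (word_offset w j)"
  by (simp add: word_offset_def)

lemma strict_mono_word_offset: "strict_mono (word_offset w)"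
proof -
  have "s < next_offset w s" for s
    by (rule next_offset_props[of s]) simp
  then show ?thesis
    by (simp add: strict_mono_Suc_iff word_offset_Suc)
qed

lemma finite_word_block: "finite (word_block w j)"
  by (simp add: word_block_def)

text \<open>Raising the bound by \<open>i\<close> inside one block adds exactly the letters of that
  block that exceed the offset by at most \<open>i\<close>.\<close>

lemma card_word_block_le:
  assumes "word_offset w j + i \<le> word_offset w (Suc j)"
  shows "letters_le w (word_offset w j + i) = letters_le w (word_offset w j) +
    card {p \<in> word_block w j. w ! (p - 1) - word_offset w j \<le> i}"
proof -
  have L: "letters_le w a = card {p \<in> {1..length w}. w ! (p - 1) \<le> a}" for a
  proof -
    have "{p \<in> {1..length w}. w ! (p - 1) \<le> a} = Suc ` {j. j < length w \<and> w ! j \<le> a}"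
      by (force simp: image_iff Suc_le_eq gr0_conv_Suc)
    then show ?thesis
      by (simp add: card_image card_letters_le)
  qed
  have "{p \<in> {1..length w}. w ! (p - 1) \<le> word_offset w j + i} =
    {p \<in> {1..length w}. w ! (p - 1) \<le> word_offset w j} \<union>
    {p \<in> word_block w j. w ! (p - 1) - word_offset w j \<le> i}"
    using assms by (auto simp: word_block_def)
  moreover have "{p \<in> {1..length w}. w ! (p - 1) \<le> word_offset w j} \<inter>
    {p \<in> word_block w j. w ! (p - 1) - word_offset w j \<le> i} = {}"
    by (auto simp: word_block_def)
  ultimately show ?thesis
    unfolding L using finite_word_block by (simp add: card_Un_disjoint)
qed

text \<open>Let \<open>k\<close> be the greedy step. Its defining inequality allows at most
  \<open>k\<close> letters in the block, minimality at \<open>k - 1\<close> forces \<open>k\<close>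
  of them unless \<open>k = 1\<close>, and minimality at smaller arguments is the primality
  condition.\<close>

lemma columns_of_prime:
  "prime_parking_function (col_word (columns_of w) j)"
  and col_offset_columns_of: "col_offset (columns_of w) j = word_offset w j"
proof -
  have *: "prime_parking_function (col_word (columns_of w) j) \<and>
    word_offset w (Suc j) = word_offset w j + col_weight (word_block w j)" for j
  proof -
    let ?s = "word_offset w j" and ?L = "word_block w j" and ?u = "col_word (columns_of w) j"
    obtain k where k: "word_offset w (Suc j) = ?s + k" "1 \<le> k"
      "letters_le w (?s + k) \<le> letters_le w ?s + k"
      and k_min: "\<And>i. 1 \<le> i \<Longrightarrow> i < k \<Longrightarrow> letters_le w ?s + i < letters_le w (?s + i)"
      using next_offset_props[of ?s] unfolding word_offset_Suc by blast
    have u: "letters_le ?u i = card {p \<in> ?L. w ! (p - 1) - ?s \<le> i}" for i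
      using finite_word_block by (simp add: columns_of_def letters_le_map)
    have u_eq: "letters_le w (?s + i) = letters_le w ?s + letters_le ?u i" if "i \<le> k" for i
      unfolding u using that k by (intro card_word_block_le) simp
    have u_le: "\<forall>a\<in>set ?u. 1 \<le> a \<and> a \<le> k"
      using k finite_word_block by (auto simp: columns_of_def word_block_def)
    then have len_k: "letters_le ?u k = length ?u"
      by (simp add: letters_le_eq_length_iff)
    have len: "length ?u = card ?L"
      by (simp add: columns_of_def)
    have le: "card ?L \<le> k"
      using len len_k k u_eq[of k] by simp
    have W: "col_weight ?L = k" and ne: "?L \<noteq> {} \<Longrightarrow> card ?L = k"
    proof -
      \<comment> \<open>For \<open>k = 1\<close> the block may be empty; \<open>col_weight\<close>
        gives the empty set weight 1, so the weight is still \<open>k\<close>.\<close>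
      have "card ?L = k \<or> (k = 1 \<and> ?L = {})"
      proof (cases "k = 1")
        case True
        then show ?thesis
          using le finite_word_block[of j] by (auto simp: le_Suc_eq)
      next
        case False
        then have "letters_le w ?s + (k - 1) < letters_le w (?s + (k - 1))"
          using k by (intro k_min) auto
        then have "k - 1 < card ?L"
          using u_eq[of "k - 1"] letters_le_le_length[of ?u "k - 1"] len by simp
        then show ?thesis
          using le by (intro disjI1) arith
      qed
      then show "col_weight ?L = k" "?L \<noteq> {} \<Longrightarrow> card ?L = k"
        using k(2) by (auto simp: col_weight_def)
    qed
    have "prime_parking_function ?u"
      unfolding prime_parking_function_iff
    proof (intro conjI allI impI ballI)
      show "?u \<in> words"
        using u_le by (auto simp: words_def)
      show "i < letters_le ?u i" if "1 \<le> i \<and> i < length ?u" for i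
        using that k_min[of i] u_eq[of i] le len by simp
      show "a \<le> length ?u" if "a \<in> set ?u" for a
      proof -
        have "?L \<noteq> {}"
          using that by (auto simp: columns_of_def)
        then show ?thesis
          using that u_le ne len by auto
      qed
    qed
    with k W show ?thesis
      by simp
  qed
  then show "prime_parking_function (col_word (columns_of w) j)"
    by blast
  show "col_offset (columns_of w) j = word_offset w j"
  proof (induction j)
    case (Suc j)
    then show ?case
      using * by (simp add: col_offset_Suc) (simp add: columns_of_def)
  qed (simp add: word_offset_def)
qed

context
  assumes w: "w \<in> words"
begin

lemma Union_word_block: "(\<Union>j. word_block w j) = {1..length w}"
proof (intro set_eqI iffI)
  fix p assume p: "p \<in> {1..length w}"
  let ?a = "w ! (p - 1)"
  have "1 \<le> ?a"
    using w p by (auto simp: words_def)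
  then have "word_offset w 0 < ?a"
    by (simp add: word_offset_def)
  \<comment> \<open>A strictly increasing sequence of naturals dominates its index, so the search
    for the interval may stop at index \<open>?a\<close>.\<close>
  moreover have "?a \<le> word_offset w ?a"
    using strict_mono_imp_increasing[OF strict_mono_word_offset] .
  ultimately obtain i where "word_offset w i < ?a" "?a \<le> word_offset w (Suc i)"
    using between_consecutive by blast
  then have "p \<in> word_block w i"
    using p by (simp add: word_block_def)
  then show "p \<in> (\<Union>j. word_block w j)"
    by blast
qed (auto simp: word_block_def)

lemma columns_of_in_BW: "columns_of w \<in> BW"
proof -
  have "i = j" if "p \<in> word_block w i" "p \<in> word_block w j" for i j p
  proof -
    have "word_offset w i < word_offset w (Suc j)" "word_offset w j < word_offset w (Suc i)"
      using that by (auto simp: word_block_def)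
    then show ?thesis
      by (auto simp: strict_mono_less[OF strict_mono_word_offset])
  qed
  then have "disjoint_family (word_block w)"
    by (auto simp: disjoint_family_on_def)
  then have "disjoint_family (col_set (columns_of w))"
    by (simp add: columns_of_def)
  moreover have "(\<Union>j. col_set (columns_of w) j) = {1..length w}"
    using Union_word_block by (simp add: columns_of_def)
  moreover have "length (col_word (columns_of w) j) = card (col_set (columns_of w) j)" for j
    by (simp add: columns_of_def)
  ultimately show ?thesis
    unfolding BW_def using columns_of_prime by blast
qed

lemma Phi_columns_of: "Phi (columns_of w) = w"
proof -
  let ?m = "columns_of w"
  note m = columns_of_in_BW
  have len: "BW_length ?m = length w"
    using Union_word_block by (simp add: BW_length_def columns_of_def)
  have "BW_letter ?m p = w ! (p - 1)" if p: "p \<in> {1..length w}" for p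
  proof -
    obtain j where j: "p \<in> word_block w j"
      using Union_word_block p by blast
    let ?L = "word_block w j"
    let ?t = "card {q \<in> ?L. q < p}"
    have "p \<in> set (sorted_list_of_set ?L)"
      using j finite_word_block by simp
    then obtain t where t: "t < card ?L" "sorted_list_of_set ?L ! t = p"
      by (auto simp: in_set_conv_nth)
    then have "?t = t"
      using rank_sorted_list_of_set[OF finite_word_block t(1)] by simp
    then have "col_word ?m j ! ?t = w ! (p - 1) - word_offset w j"
      using t by (simp add: columns_of_def)
    moreover have "p \<in> col_set ?m j" "col_set ?m j = ?L"
      using j by (simp_all add: columns_of_def)
    ultimately have "BW_letter ?m p = w ! (p - 1) - word_offset w j + word_offset w j"
      using BW_letter_eq[OF m, of p j] by (simp add: col_offset_columns_of)
    \<comment> \<open>Letters of the block exceed the offset, so adding it back undoes the truncated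
      subtraction.\<close>
    then show ?thesis
      using j by (simp add: word_block_def)
  qed
  then have "Phi ?m ! i = w ! i" if "i < length w" for i
    using Phi_nth[OF m, of "Suc i"] that len by simp
  then show ?thesis
    using len by (intro nth_equalityI) (simp_all add: length_Phi[OF m])
qed

end

end

lemma bij_betw_Phi: "bij_betw Phi BW words"
  by (rule bij_betw_byWitness[where f' = columns_of])
    (auto simp: columns_of_Phi Phi_columns_of Phi_in_words columns_of_in_BW)

lemma inv_into_Phi: "w \<in> words \<Longrightarrow> inv_into BW Phi w = columns_of w"
  using bij_betw_Phi
  by (intro inv_into_f_eq) (auto simp: bij_betw_def columns_of_in_BW Phi_columns_of)

subsection \<open>Parkization deletes empty columns\<close>

lemma park_step_in_words:
  assumes "w \<in> words"
  shows "park_step w \<in> words"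
  using assms park_defect_props(1)[of w] by (auto simp: words_def park_step_def)

lemma length_Park: "length (Park w) = length w"
proof (induction w rule: Park.induct)
  case (1 w)
  then show ?case
    by (subst Park.simps) (simp add: park_step_def)
qed

text \<open>The parking condition fails at some \<open>i \<le> length u\<close> exactly when the
  defect is smaller than its maximal value \<open>length u + 1\<close>. So parking functions are the
  words at which \<open>Park\<close> stops.\<close>

lemma parking_function_iff_park_defect:
  "parking_function u \<longleftrightarrow> u \<in> words \<and> park_defect u = length u + 1"
proof
  assume p: "parking_function u"
  show "u \<in> words \<and> park_defect u = length u + 1"
  proof (rule ccontr)
    assume "\<not> ?thesis"
    then have "park_defect u \<in> {1..length u}"
      using p park_defect_props(1,3)[of u] by (auto simp: parking_function_iff)
    then show False
      using p park_defect_props(2)[of u] unfolding parking_function_iff card_letters_le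
      by (meson not_le)
  qed
next
  assume u: "u \<in> words \<and> park_defect u = length u + 1"
  have "i \<le> letters_le u i" if "i \<in> {1..length u}" for i
  proof -
    have "i < park_defect u"
      using that u by auto
    then show ?thesis
      using not_less_Least[of i] that unfolding park_defect_def card_letters_le by fastforce
  qed
  then show "parking_function u"
    using u by (simp add: parking_function_iff)
qed

lemma parking_function_Park: "w \<in> words \<Longrightarrow> parking_function (Park w)"
proof (induction w rule: Park.induct)
  case (1 w)
  then show ?case
    by (subst Park.simps) (simp add: parking_function_iff_park_defect park_step_in_words)
qed

lemma Park_parking_function: "parking_function u \<Longrightarrow> Park u = u"
  by (subst Park.simps) (simp add: parking_function_iff_park_defect)

section \<open>The first empty column and the defect\<close>

lemma finite_nonempty_columns:
  assumes m: "m \<in> BW"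
  shows "finite {i. col_set m i \<noteq> {}}"
proof (rule finite_surj)
  show "finite {1..BW_length m}"
    by simp
  \<comment> \<open>Every nonempty column is the column of one of the finitely many
    positions.\<close>
  show "{i. col_set m i \<noteq> {}} \<subseteq> (\<lambda>p. THE i. p \<in> col_set m i) ` {1..BW_length m}"
  proof
    fix i assume "i \<in> {i. col_set m i \<noteq> {}}"
    then obtain p where p: "p \<in> col_set m i"
      by blast
    then have "(THE i. p \<in> col_set m i) = i"
      using col_set_unique[OF m] by blast
    then show "i \<in> (\<lambda>p. THE i. p \<in> col_set m i) ` {1..BW_length m}"
      using p col_set_subset[OF m, of i] by (intro image_eqI[of _ _ p]) auto
  qed
qed

lemma first_empty_column:
  assumes m: "m \<in> BW"
  obtains j where "col_set m j = {}" "\<And>i. i < j \<Longrightarrow> col_set m i \<noteq> {}"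
proof -
  have "\<exists>j. col_set m j = {}"
    using ex_new_if_finite[OF _ finite_nonempty_columns[OF m]] by auto
  then show thesis
    using that[of "LEAST j. col_set m j = {}"] LeastI_ex not_less_Least
    by (metis (mono_tags, lifting))
qed

text \<open>Each nonempty column contributes as many letters as its weight, so the count keeps pace
  with the offset as long as no empty column has occurred.\<close>

lemma letters_le_Phi_nonempty:
  assumes m: "m \<in> BW" and ne: "\<And>i. i < j \<Longrightarrow> col_set m i \<noteq> {}"
  shows "letters_le (Phi m) (col_offset m j) = col_offset m j"
  using ne
proof (induction j)
  case 0
  have "filter (\<lambda>x. x \<le> 0) (Phi m) = []"
    using Phi_in_words[OF m] by (auto simp: words_def filter_empty_conv)
  then show ?case
    by (simp add: letters_le_def)
next
  case (Suc j)
  let ?u = "col_word m j"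
  have W: "col_weight (col_set m j) = length ?u"
    using Suc.prems[of j] by (simp add: col_weight_def length_col_word[OF m])
  have "letters_le ?u (length ?u) = length ?u"
    using prime_col_word[OF m, of j] by (simp add: letters_le_eq_length_iff prime_parking_function_iff)
  then show ?case
    using letters_le_Phi_offset[OF m, of "length ?u" j] Suc by (simp add: col_offset_Suc W)
qed

text \<open>Just above the offset the empty column adds no letter, so the count falls short there. A
  smaller positive \<open>y\<close> lies in a nonempty column \<open>q\<close>, and for
  \<open>k = y - col_offset m q\<close> the prime word of that column has at least \<open>k\<close>
  letters at most \<open>k\<close>.\<close>

lemma park_defect_Phi:
  assumes m: "m \<in> BW" and e: "col_set m j = {}" and ne: "\<And>i. i < j \<Longrightarrow> col_set m i \<noteq> {}"
  shows "park_defect (Phi m) = Suc (col_offset m j)"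
  unfolding park_defect_def card_letters_le
proof (rule Least_equality)
  have "letters_le (Phi m) (col_offset m j + 1) = col_offset m j"
    using letters_le_Phi_offset[OF m, of 1 j] letters_le_Phi_nonempty[OF m ne] e
    by (simp add: col_weight_def empty_col[OF m e] letters_le_def)
  then show "1 \<le> Suc (col_offset m j) \<and> letters_le (Phi m) (Suc (col_offset m j)) < Suc (col_offset m j)"
    by simp
next
  fix y assume y: "1 \<le> y \<and> letters_le (Phi m) y < y"
  show "Suc (col_offset m j) \<le> y"
  proof (rule ccontr)
    assume "\<not> ?thesis"
    then have "y \<le> col_offset m j" by simp
    then obtain q where q: "q < j" "col_offset m q < y" "y \<le> col_offset m (Suc q)"
      using between_consecutive[of "col_offset m" y j] y by auto
    let ?u = "col_word m q"
    define k where "k = y - col_offset m q"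
    have W: "col_weight (col_set m q) = length ?u"
      using ne[OF q(1)] by (simp add: col_weight_def length_col_word[OF m])
    have k: "y = col_offset m q + k" "1 \<le> k" "k \<le> length ?u"
      using q by (auto simp: k_def col_offset_Suc W)
    have "letters_le ?u (length ?u) = length ?u"
      using prime_col_word[OF m, of q] by (simp add: letters_le_eq_length_iff prime_parking_function_iff)
    then have "k \<le> letters_le ?u k"
      using k prime_col_word[OF m, of q]
      by (cases "k = length ?u") (auto simp: prime_parking_function_iff less_imp_le)
    moreover have "letters_le (Phi m) (col_offset m q) = col_offset m q"
      using q(1) ne by (intro letters_le_Phi_nonempty[OF m]) simp
    ultimately show False
      using y k letters_le_Phi_offset[OF m, of k q] by (simp add: W)
  qed
qed

section \<open>Deletion of an empty column\<close>

definition skip :: "nat \<Rightarrow> nat \<Rightarrow> nat" where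
  "skip j i = (if i < j then i else Suc i)"

lemma strict_mono_skip: "strict_mono (skip j)"
  by (simp add: strict_mono_Suc_iff skip_def)

lemma range_skip: "range (skip j) = - {j}"
proof -
  have "i \<in> range (skip j)" if "i \<noteq> j" for i
    using that by (intro image_eqI[of _ _ "if i < j then i else i - 1"]) (auto simp: skip_def)
  then show ?thesis
    by (auto simp: skip_def)
qed

definition remove_column :: "nat \<Rightarrow> columns \<Rightarrow> columns" where
  "remove_column j m i = m (skip j i)"

lemma remove_column_in_BW:
  assumes m: "m \<in> BW" and e: "col_set m j = {}"
  shows "remove_column j m \<in> BW"
    and "BW_length (remove_column j m) = BW_length m"
proof -
  have "(\<Union>i. col_set (remove_column j m) i) = (\<Union>i\<in>range (skip j). col_set m i)"
    by (simp add: remove_column_def)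
  also have "\<dots> = (\<Union>i. col_set m i)"
    unfolding range_skip using e by blast
  finally have U: "(\<Union>i. col_set (remove_column j m) i) = (\<Union>i. col_set m i)" .
  then show "BW_length (remove_column j m) = BW_length m"
    by (simp add: BW_length_def)
  have "disjoint_family (col_set (remove_column j m))"
    using col_set_unique[OF m] strict_mono_eq[OF strict_mono_skip]
    by (fastforce simp: disjoint_family_on_def remove_column_def)
  then show "remove_column j m \<in> BW"
    unfolding BW_def mem_Collect_eq U Union_col_set[OF m]
    using prime_col_word[OF m] length_col_word[OF m] by (auto simp: remove_column_def)
qed

text \<open>The empty column has weight 1, and this unit is missing from the offsets of exactly
  those columns that stood to the right of it.\<close>

lemma col_offset_remove_column:
  assumes e: "col_set m j = {}"
  shows "col_offset m (skip j i) = col_offset (remove_column j m) i + of_bool (j \<le> i)"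
proof (induction i)
  case 0
  then show ?case
    using e by (auto simp: skip_def col_offset_Suc col_weight_def)
next
  case (Suc i)
  consider "Suc i < j" | "Suc i = j" | "j \<le> i"
    by linarith
  then show ?case
  proof cases
    case 2
    then have "j = Suc i"
      by simp
    with Suc e show ?thesis
      by (simp add: skip_def col_offset_Suc remove_column_def col_weight_def)
  qed (use Suc in \<open>simp_all add: skip_def col_offset_Suc remove_column_def\<close>)
qed

text \<open>Columns to the right of \<open>j\<close> have their letters above the defect and lose
  one unit of offset; columns to the left have letters at most \<open>col_offset m j\<close>, below
  the defect, and stay.\<close>

lemma Phi_remove_column:
  assumes m: "m \<in> BW" and e: "col_set m j = {}" and ne: "\<And>i. i < j \<Longrightarrow> col_set m i \<noteq> {}"
  shows "Phi (remove_column j m) = park_step (Phi m)"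
proof -
  let ?d = "Suc (col_offset m j)"
  have "BW_letter (remove_column j m) p =
      (if ?d < BW_letter m p then BW_letter m p - 1 else BW_letter m p)"
    if p: "p \<in> {1..BW_length m}" for p
  proof -
    obtain i' where i': "p \<in> col_set m i'"
      using col_set_cover[OF m p] by blast
    with e have "i' \<in> range (skip j)"
      unfolding range_skip by auto
    then obtain i where i: "i' = skip j i"
      by blast
    have p': "p \<in> col_set (remove_column j m) i"
      using i i' by (simp add: remove_column_def)
    have "BW_letter m p = BW_letter (remove_column j m) p + of_bool (j \<le> i)"
      unfolding BW_letter_eq[OF m i'] BW_letter_eq[OF remove_column_in_BW(1)[OF m e] p']
      by (simp add: i col_offset_remove_column[where m = m, OF e]) (simp add: remove_column_def)
    moreover have "?d < BW_letter m p \<longleftrightarrow> j \<le> i"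
    proof (cases "j \<le> i")
      case True
      then have "Suc j \<le> i'"
        by (simp add: i skip_def)
      then have "col_offset m (Suc j) \<le> col_offset m i'"
        using strict_mono_less_eq[OF strict_mono_col_offset[OF m]] by blast
      then show ?thesis
        using True BW_letter_bounds(1)[OF m i'] e by (simp add: col_offset_Suc col_weight_def)
    next
      case False
      then have "Suc i' \<le> j"
        by (simp add: i skip_def)
      then have "col_offset m (Suc i') \<le> col_offset m j"
        using strict_mono_less_eq[OF strict_mono_col_offset[OF m]] by blast
      then show ?thesis
        using False BW_letter_bounds(2)[OF m i'] by simp
    qed
    ultimately show ?thesis
      by simp
  qed
  moreover have "park_defect (Phi m) = ?d"
    by (rule park_defect_Phi[OF m e ne])
  ultimately show ?thesis
    unfolding park_step_def
    by (simp only:) (auto simp: Phi_def remove_column_in_BW(2)[OF m e] simp del: upt_Suc)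
qed

text \<open>Since \<open>j\<close> is outside \<open>J\<close>, \<open>skip j\<close> is an
  increasing bijection from the preimage onto \<open>J\<close>. It preserves the number of occupied
  positions below a position, hence the index into \<open>C\<close>.\<close>

lemma placed_at_remove_column:
  assumes p: "placed_at J C m" and e: "col_set m j = {}"
  shows "placed_at (skip j -` J) C (remove_column j m)" "card (skip j -` J) = card J"
proof -
  have m: "m i = (if i \<in> J then C (card (J \<inter> {..<i})) else ({}, []))"
    and J: "col_set m i \<noteq> {} \<longleftrightarrow> i \<in> J" for i
    using p[unfolded placed_at_def, THEN conjunct1, rule_format]
      p[unfolded placed_at_def, THEN conjunct2, rule_format] by - (assumption+)
  have "j \<notin> J"
    using J e by blast
  then have img: "skip j ` (skip j -` J) = J"
    unfolding image_vimage_eq range_skip by blast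
  then show "card (skip j -` J) = card J"
    using card_image[of "skip j" "skip j -` J"] strict_mono_imp_inj_on[OF strict_mono_skip, of j]
    by (simp add: inj_on_subset)
  have "card (J \<inter> {..<skip j i}) = card ((skip j -` J) \<inter> {..<i})" for i
  proof -
    have "J \<inter> {..<skip j i} = skip j ` ((skip j -` J) \<inter> {..<i})"
    proof (intro set_eqI iffI)
      fix x assume "x \<in> J \<inter> {..<skip j i}"
      moreover from this obtain y where "x = skip j y" "y \<in> skip j -` J"
        using img by blast
      ultimately show "x \<in> skip j ` ((skip j -` J) \<inter> {..<i})"
        by (simp add: strict_mono_less[OF strict_mono_skip])
    qed (auto simp: strict_mono_less[OF strict_mono_skip])
    then show ?thesis
      using strict_mono_imp_inj_on[OF strict_mono_skip] by (metis card_image)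
  qed
  then have "m (skip j i) =
      (if i \<in> skip j -` J then C (card ((skip j -` J) \<inter> {..<i})) else ({}, []))" for i
    unfolding m[of "skip j i"] by simp
  then show "placed_at (skip j -` J) C (remove_column j m)"
    unfolding placed_at_def remove_column_def J vimage_eq by blast
qed

text \<open>Each parkization step deletes the first empty column and keeps \<open>C\<close>, so in
  the end the nonempty columns occupy the initial positions. The induction is on the letter sum,
  which every step decreases.\<close>

lemma Park_Phi:
  assumes "m \<in> BW" "placed_at J C m"
  shows "\<exists>m'\<in>BW. placed_at {..<card J} C m' \<and> Park (Phi m) = Phi m'"
  using assms
proof (induction "sum_list (Phi m)" arbitrary: m J rule: less_induct)
  case (less m J)
  note m = less.prems(1) and p = less.prems(2)
  have J: "col_set m i \<noteq> {} \<longleftrightarrow> i \<in> J" for i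
    using p[unfolded placed_at_def, THEN conjunct2, rule_format] .
  obtain j where e: "col_set m j = {}" and ne: "\<And>i. i < j \<Longrightarrow> col_set m i \<noteq> {}"
    using first_empty_column[OF m] by blast
  show ?case
  proof (cases "park_defect (Phi m) = length (Phi m) + 1")
    case True
    \<comment> \<open>The defect is one more than the offset of the first empty column, so that
      offset is the length of the word and no letter lies beyond it.\<close>
    then have "letters_le (Phi m) (col_offset m j) = length (Phi m)"
      using letters_le_Phi_nonempty[where j = j, OF m ne] park_defect_Phi[OF m e ne] by simp
    then have le: "\<forall>x\<in>set (Phi m). x \<le> col_offset m j"
      by (simp add: letters_le_eq_length_iff)
    have "col_set m i = {}" if "j \<le> i" for i
    proof (rule ccontr)
      assume "col_set m i \<noteq> {}"
      then obtain q where q: "q \<in> col_set m i"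
        by blast
      then have "q \<in> {1..BW_length m}"
        using col_set_subset[OF m] by blast
      then have "BW_letter m q \<le> col_offset m j"
        using le by (simp add: Phi_def del: upt_Suc)
      moreover have "col_offset m j \<le> col_offset m i"
        using that strict_mono_less_eq[OF strict_mono_col_offset[OF m]] by blast
      ultimately show False
        using BW_letter_bounds(1)[OF m q] by simp
    qed
    then have "i \<in> J \<longleftrightarrow> i < j" for i
      using J[of i] ne[of i] by (cases "i < j") auto
    then have "J = {..<j}"
      by blast
    then have "placed_at {..<card J} C m"
      using p by simp
    then show ?thesis
      using m True by (subst Park.simps) auto
  next
    case False
    have "sum_list (Phi (remove_column j m)) < sum_list (Phi m)"
      using sum_list_park_step[OF False] by (simp add: Phi_remove_column[OF m e ne])
    from less.hyps[OF this remove_column_in_BW(1)[OF m e] placed_at_remove_column(1)[OF p e]]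
    show ?thesis
      using False by (subst Park.simps) (simp add: placed_at_remove_column(2)[OF p e] Phi_remove_column[OF m e ne])
  qed
qed

subsection \<open>Orbits\<close>

text \<open>A bijection from \<open>A\<close> to \<open>B\<close> is completed by one between the
  complements inside \<open>A \<union> B\<close>, which have equal size, and by the identity outside
  this finite set.\<close>

lemma ex_permutation_image_eq:
  assumes "finite A" "finite B" "card A = card B"
  shows "\<exists>\<sigma>. permutation \<sigma> \<and> \<sigma> ` A = B"
proof -
  let ?S = "A \<union> B"
  obtain f where f: "bij_betw f A B"
    using finite_same_card_bij assms by blast
  have "card (?S - A) = card (?S - B)"
    using assms by (simp add: card_Diff_subset)
  then obtain g where g: "bij_betw g (?S - A) (?S - B)"
    using finite_same_card_bij[of "?S - A" "?S - B"] assms by auto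
  define h where "h x = (if x \<in> A then f x else if x \<in> ?S then g x else x)" for x
  have hA: "bij_betw h A B"
    using f by (rule bij_betw_cong[THEN iffD1, rotated]) (simp add: h_def)
  have "bij_betw h (?S - A) (?S - B)"
    using g by (rule bij_betw_cong[THEN iffD1, rotated]) (auto simp: h_def)
  with hA have "bij_betw h (A \<union> (?S - A)) (B \<union> (?S - B))"
    by (rule bij_betw_combine) auto
  then have "bij_betw h ?S ?S"
    by (simp add: Un_absorb1 Un_commute)
  then have "h permutes ?S"
    by (rule bij_imp_permutes) (simp add: h_def)
  then have "permutation h"
    using assms by (auto simp: permutation_permutes)
  then show ?thesis
    using hA by (auto simp: bij_betw_def)
qed

text \<open>A swap that takes place reindexes the columns by a transposition, and the conditions in
  \<open>BW\<close> do not depend on the indexing.\<close>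

lemma swap_columns_in_BW:
  assumes m: "m \<in> BW"
  shows "swap_columns i m \<in> BW"
proof (cases "col_set m i = {} \<or> col_set m (Suc i) = {}")
  case True
  let ?s = "transpose i (Suc i)"
  have sw: "swap_columns i m = m \<circ> ?s"
    using True by (auto simp: swap_columns_def transpose_def)
  have "(\<Union>k. col_set (m \<circ> ?s) k) = (\<Union>k\<in>range ?s. col_set m k)"
    by (simp only: comp_apply image_comp[unfolded comp_def])
  then have U: "(\<Union>k. col_set (m \<circ> ?s) k) = {1..BW_length m}"
    by (simp only: surj_transpose Union_col_set[OF m])
  have "disjoint_family (col_set (m \<circ> ?s))"
    unfolding disjoint_family_on_def
  proof (intro ballI impI)
    fix k l :: nat assume "k \<noteq> l"
    then have "?s k \<noteq> ?s l"
      using inj_transpose[of i "Suc i"] by (simp add: inj_eq)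
    then show "col_set (m \<circ> ?s) k \<inter> col_set (m \<circ> ?s) l = {}"
      using col_set_unique[OF m] by fastforce
  qed
  then show ?thesis
    unfolding sw BW_def mem_Collect_eq U
    using prime_col_word[OF m] length_col_word[OF m] by auto
qed (simp add: swap_columns_def m)

lemma foldr_swap_columns_in_BW: "m \<in> BW \<Longrightarrow> foldr swap_columns is m \<in> BW"
  by (induction "is") (auto intro: swap_columns_in_BW)

section \<open>The action on words\<close>

lemma word_action_generator_product:
  "w \<in> words \<Longrightarrow>
    word_action (generator_product is) w = Phi (foldr swap_columns is (columns_of w))"
  by (simp add: word_action_def inv_into_Phi BW_action_generator_product columns_of_in_BW)

lemma word_action_in_words:
  assumes "permutation \<sigma>" "w \<in> words"
  shows "word_action \<sigma> w \<in> words"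
  using permutation_generated[OF assms(1)] assms(2)
  by (auto simp: word_action_generator_product foldr_swap_columns_in_BW columns_of_in_BW Phi_in_words)

lemma word_action_id: "w \<in> words \<Longrightarrow> word_action id w = w"
  using word_action_generator_product[of w "[]"] by (simp add: Phi_columns_of)

text \<open>Factorizations of the two permutations concatenate to one of the composite, and the
  action may be evaluated through any factorization.\<close>

lemma word_action_comp:
  assumes "permutation \<sigma>" "permutation \<tau>" "w \<in> words"
  shows "word_action (\<sigma> \<circ> \<tau>) w = word_action \<sigma> (word_action \<tau> w)"
proof -
  obtain "is" js where g: "generator_product is = \<sigma>" "generator_product js = \<tau>"
    using assms permutation_generated by meson
  let ?m = "foldr swap_columns js (columns_of w)"
  have m: "?m \<in> BW"
    using assms(3) by (simp add: foldr_swap_columns_in_BW columns_of_in_BW)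
  have "word_action \<tau> w = Phi ?m"
    using word_action_generator_product[OF assms(3), of js] g by simp
  moreover have "word_action \<sigma> (Phi ?m) = Phi (foldr swap_columns is ?m)"
    using word_action_generator_product[OF Phi_in_words[OF m], of "is"] g
    by (simp add: columns_of_Phi[OF m])
  moreover have "word_action (\<sigma> \<circ> \<tau>) w = Phi (foldr swap_columns (is @ js) (columns_of w))"
    using word_action_generator_product[OF assms(3), of "is @ js"] g
    by (simp add: generator_product_append)
  ultimately show ?thesis
    by simp
qed

text \<open>The action moves the occupied positions and keeps \<open>C\<close>, while the
  parkization depends only on \<open>C\<close> and the number of occupied positions.\<close>

lemma Park_word_action:
  assumes "permutation \<sigma>" "w \<in> words"
  shows "Park (word_action \<sigma> w) = Park w"
proof -
  obtain "is" where g: "generator_product is = \<sigma>"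
    using permutation_generated[OF assms(1)] by blast
  let ?m = "columns_of w" and ?m' = "foldr swap_columns is (columns_of w)"
  have m: "?m \<in> BW"
    by (rule columns_of_in_BW[OF assms(2)])
  then obtain J C where p: "placed_at J C ?m"
    using BW_placed_at by blast
  have p': "placed_at (\<sigma> ` J) C ?m'"
    using placed_at_foldr[OF p, of "is"] g by simp
  have "card (\<sigma> ` J) = card J"
    using permutation_bijective[OF assms(1)] by (meson bij_is_inj card_image inj_on_subset subset_UNIV)
  then obtain n n' where "placed_at {..<card J} C n" "placed_at {..<card J} C n'"
    and "Park (Phi ?m) = Phi n" "Park (Phi ?m') = Phi n'"
    using Park_Phi[OF m p] Park_Phi[OF foldr_swap_columns_in_BW[OF m] p'] by auto
  then have "Park (Phi ?m') = Park (Phi ?m)"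
    using placed_at_unique by metis
  then show ?thesis
    using word_action_generator_product[OF assms(2), of "is"] g by (simp add: Phi_columns_of[OF assms(2)])
qed

text \<open>Words with equal parkizations have the same nonempty columns in the same order, so they
  differ only in the occupied positions, and some permutation carries one set of positions onto the
  other.\<close>

lemma Park_eq_imp_word_action:
  assumes w: "w \<in> words" "w' \<in> words" and eq: "Park w' = Park w"
  shows "\<exists>\<sigma>. permutation \<sigma> \<and> word_action \<sigma> w = w'"
proof -
  let ?m = "columns_of w" and ?m' = "columns_of w'"
  have m: "?m \<in> BW" "?m' \<in> BW"
    using w by (simp_all add: columns_of_in_BW)
  then obtain J C J' C' where p: "placed_at J C ?m" and p': "placed_at J' C' ?m'"
    using BW_placed_at by meson
  obtain n n' where n: "n \<in> BW" "placed_at {..<card J} C n" "Park w = Phi n"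
    and n': "n' \<in> BW" "placed_at {..<card J'} C' n'" "Park w' = Phi n'"
    using Park_Phi[OF m(1) p] Park_Phi[OF m(2) p'] w by (auto simp: Phi_columns_of)
  \<comment> \<open>\<open>Phi\<close> is injective on \<open>BW\<close>, with left inverse
    \<open>columns_of\<close>.\<close>
  have "n = n'"
    using n n' eq by (metis columns_of_Phi)
  have nz: "{i. col_set x i \<noteq> {}} = K" if "placed_at K D x" for K D x
    using that unfolding placed_at_def by blast
  have fin: "finite J" "finite J'"
    using finite_nonempty_columns[OF m(1)] finite_nonempty_columns[OF m(2)] nz[OF p] nz[OF p'] by simp_all
  have card: "card J = card J'"
    using nz[OF n(2)] nz[OF n'(2)] \<open>n = n'\<close> by simp
  \<comment> \<open>\<open>placed_at\<close> fixes the values of \<open>C\<close> only below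
    \<open>card J\<close>, so agreement of \<open>C\<close> and \<open>C'\<close> is available only
    there; the ranks of the elements of \<open>J'\<close> stay in this range.\<close>
  have C: "C i = C' i" if "i < card J" for i
  proof -
    have "{..<card J} \<inter> {..<i} = {..<i}"
      using that by auto
    then have "n i = C i" "n' i = C' i"
      using n(2) n'(2) that card unfolding placed_at_def by simp_all
    then show ?thesis
      using \<open>n = n'\<close> by simp
  qed
  have "C (card (J' \<inter> {..<i})) = C' (card (J' \<inter> {..<i}))" if "i \<in> J'" for i
  proof (rule C)
    have "J' \<inter> {..<i} \<subset> J'"
      using that by blast
    then show "card (J' \<inter> {..<i}) < card J"
      using fin card by (simp add: psubset_card_mono)
  qed
  then have eq_C': "(if i \<in> J' then C (card (J' \<inter> {..<i})) else ({}, [])) =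
      (if i \<in> J' then C' (card (J' \<inter> {..<i})) else ({}, []))" for i
    by simp
  have p'': "placed_at J' C ?m'"
    using p' unfolding placed_at_def eq_C' .
  obtain \<sigma> where \<sigma>: "permutation \<sigma>" "\<sigma> ` J = J'"
    using ex_permutation_image_eq[OF fin card] by blast
  obtain "is" where g: "generator_product is = \<sigma>"
    using permutation_generated[OF \<sigma>(1)] by blast
  have "foldr swap_columns is ?m = ?m'"
    using placed_at_unique[OF placed_at_foldr[OF p, of "is"]] p'' g \<sigma>(2) by simp
  then have "word_action \<sigma> w = w'"
    using word_action_generator_product[OF w(1), of "is"] g by (simp add: Phi_columns_of[OF w(2)])
  with \<sigma>(1) show ?thesis
    by blast
qed

theorem Orb_eq_Park_class:
  assumes "w \<in> words"
  shows "Orb w = {w' \<in> words. Park w' = Park w}"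
proof (intro set_eqI iffI)
  fix v assume "v \<in> Orb w"
  then show "v \<in> {w' \<in> words. Park w' = Park w}"
    using assms by (auto simp: Orb_def word_action_in_words Park_word_action)
next
  fix v assume "v \<in> {w' \<in> words. Park w' = Park w}"
  then show "v \<in> Orb w"
    using Park_eq_imp_word_action[OF assms, of v] by (auto simp: Orb_def)
qed

subsection \<open>Invariant series\<close>

text \<open>The action of \<open>inv \<sigma>\<close> inverts that of \<open>\<sigma>\<close> on
  words, so the sum over preimages has a single term if \<open>v\<close> is a word and none
  otherwise.\<close>

lemma series_action_eq:
  assumes "permutation \<sigma>"
  shows "series_action \<sigma> f v = (if v \<in> words then f (word_action (inv \<sigma>) v) else 0)"
proof -
  have i: "permutation (inv \<sigma>)" "inv \<sigma> \<circ> \<sigma> = id" "\<sigma> \<circ> inv \<sigma> = id"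
    using assms permutation_inverse_works[OF assms] by (simp_all add: permutation_inverse)
  have "{w. w \<in> words \<and> word_action \<sigma> w = v} = (if v \<in> words then {word_action (inv \<sigma>) v} else {})"
  proof (intro set_eqI iffI)
    fix w assume w: "w \<in> {w. w \<in> words \<and> word_action \<sigma> w = v}"
    then have "word_action (inv \<sigma>) v = w"
      using word_action_comp[OF i(1) assms, of w] i(2) word_action_id by auto
    with w show "w \<in> (if v \<in> words then {word_action (inv \<sigma>) v} else {})"
      using word_action_in_words[OF assms, of w] by simp
  next
    fix w assume "w \<in> (if v \<in> words then {word_action (inv \<sigma>) v} else {})"
    then have "v \<in> words" "w = word_action (inv \<sigma>) v"
      by (auto split: if_splits)
    then show "w \<in> {w. w \<in> words \<and> word_action \<sigma> w = v}"
      using word_action_comp[OF assms i(1), of v] i(3) word_action_id word_action_in_words[OF i(1)]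
      by simp
  qed
  then show ?thesis
    by (simp add: series_action_def)
qed

text \<open>Invariance means constancy on orbits, that is on parkization classes, and each class
  contains \<open>Park w\<close> because parkization is idempotent.\<close>

lemma parking_invariant_iff:
  assumes "f \<in> word_series"
  shows "parking_invariant f \<longleftrightarrow> (\<forall>w\<in>words. f w = f (Park w))"
proof
  assume inv: "parking_invariant f"
  show "\<forall>w\<in>words. f w = f (Park w)"
  proof
    fix w assume w: "w \<in> words"
    have P: "Park w \<in> words" "Park (Park w) = Park w"
      using parking_function_Park[OF w] by (auto simp: parking_function_iff Park_parking_function)
    obtain \<sigma> where \<sigma>: "permutation \<sigma>" "word_action \<sigma> w = Park w"
      using Park_eq_imp_word_action[OF w P] by blast
    \<comment> \<open>By \<open>series_action_eq\<close> a series action evaluates \<open>f\<close>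
      along the inverse permutation, so \<open>inv \<sigma>\<close> is the one that leads to
      \<open>word_action \<sigma> w\<close>.\<close>
    have "f w = series_action (inv \<sigma>) f w"
      using inv \<sigma>(1) by (simp add: parking_invariant_def permutation_inverse)
    also have "\<dots> = f (word_action (inv (inv \<sigma>)) w)"
      using w \<sigma>(1) by (simp add: series_action_eq permutation_inverse)
    also have "inv (inv \<sigma>) = \<sigma>"
      using \<sigma>(1) by (simp add: permutation_bijective inv_inv_eq)
    finally show "f w = f (Park w)"
      using \<sigma>(2) by simp
  qed
next
  assume P: "\<forall>w\<in>words. f w = f (Park w)"
  have "series_action \<sigma> f v = f v" if \<sigma>: "permutation \<sigma>" for \<sigma> v
  proof (cases "v \<in> words")
    case True
    have "permutation (inv \<sigma>)"
      using \<sigma> by (rule permutation_inverse)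
    then have "f (word_action (inv \<sigma>) v) = f v"
      using P True Park_word_action word_action_in_words by metis
    then show ?thesis
      using True \<sigma> by (simp add: series_action_eq)
  next
    case False
    then show ?thesis
      using assms \<sigma> by (simp add: series_action_eq word_series_def)
  qed
  then show "parking_invariant f"
    by (auto simp: parking_invariant_def)
qed

section \<open>Membership in the span and in its completion\<close>

lemma G_apply: "G u w = of_bool (w \<in> words \<and> Park w = u)"
  by (simp add: G_def formal_sum_def)

text \<open>The word \<open>w\<close> occurs in \<open>G u\<close> for \<open>u = Park w\<close>
  only, so its coefficient is \<open>c (Park w)\<close>. If \<open>f\<close> is constant on
  parkization classes, \<open>f\<close> itself serves as \<open>c\<close>.\<close>

lemma PQSym_dual_completed_iff:
  fixes f :: "nat list \<Rightarrow> 'k::field_char_0"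
  assumes "f \<in> word_series"
  shows "f \<in> PQSym_dual_completed \<longleftrightarrow> (\<forall>w\<in>words. f w = f (Park w))"
proof -
  have "(\<Sum>u | parking_function u \<and> G u w \<noteq> (0::'k). c u * G u w) =
      (if w \<in> words then c (Park w) else 0)" for c :: "nat list \<Rightarrow> 'k" and w
  proof -
    have "{u. parking_function u \<and> G u w \<noteq> (0::'k)} = (if w \<in> words then {Park w} else {})"
      using parking_function_Park by (auto simp: G_apply)
    then show ?thesis
      by (simp add: G_apply)
  qed
  then have "f \<in> PQSym_dual_completed \<longleftrightarrow> (\<exists>c. \<forall>w. f w = (if w \<in> words then c (Park w) else 0))"
    by (simp add: PQSym_dual_completed_def)
  also have "\<dots> \<longleftrightarrow> (\<forall>w\<in>words. f w = f (Park w))"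
  proof
    assume "\<exists>c. \<forall>w. f w = (if w \<in> words then c (Park w) else 0)"
    then obtain c where c: "\<And>w. w \<in> words \<Longrightarrow> f w = c (Park w)"
      by auto
    show "\<forall>w\<in>words. f w = f (Park w)"
      using parking_function_Park
      by (auto simp: c parking_function_iff Park_parking_function)
  next
    assume "\<forall>w\<in>words. f w = f (Park w)"
    then show "\<exists>c. \<forall>w. f w = (if w \<in> words then c (Park w) else 0)"
      using assms by (intro exI[of _ f]) (auto simp: word_series_def)
  qed
  finally show ?thesis .
qed

text \<open>The last parking condition bounds every letter of \<open>u\<close> by its length, so
  letters and length are both at most \<open>N\<close>.\<close>

lemma finite_parking_functions: "finite {u. parking_function u \<and> length u \<le> N}"
proof (rule finite_subset)
  show "finite {xs. set xs \<subseteq> {..N} \<and> length xs \<le> N}"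
    by (rule finite_lists_length_le) simp
  have "set u \<subseteq> {..N}" if u: "parking_function u" "length u \<le> N" for u
  proof (cases "u = []")
    case False
    then have "length u \<in> {1..length u}"
      by (simp add: Suc_le_eq)
    then have "length u \<le> letters_le u (length u)"
      using u by (simp only: parking_function_iff)
    then have "letters_le u (length u) = length u"
      using letters_le_le_length[of u] by (simp add: le_antisym)
    then show ?thesis
      using u(2) by (auto simp: letters_le_eq_length_iff)
  qed simp
  then show "{u. parking_function u \<and> length u \<le> N} \<subseteq> {xs. set xs \<subseteq> {..N} \<and> length xs \<le> N}"
    by blast
qed

text \<open>Constancy on parkization classes is a linear condition that holds for each
  \<open>G u\<close>, hence on the span. Conversely the degree bound leaves finitely many parking
  functions, and \<open>f\<close> is the sum of their \<open>G u\<close> with coefficients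
  \<open>f u\<close>.\<close>

lemma PQSym_dual_iff:
  fixes f :: "nat list \<Rightarrow> 'k::field_char_0"
  assumes f: "f \<in> word_series" and "bounded_degree f"
  shows "f \<in> PQSym_dual \<longleftrightarrow> (\<forall>w\<in>words. f w = f (Park w))"
proof
  let ?V = "{g :: nat list \<Rightarrow> 'k. \<forall>w\<in>words. g w = g (Park w)}"
  assume "f \<in> PQSym_dual"
  moreover have "series.span {G u | u. parking_function u} \<subseteq> ?V"
  proof (rule series.span_minimal)
    show "{G u | u. parking_function u} \<subseteq> ?V"
      using parking_function_Park by (auto simp: G_apply parking_function_iff Park_parking_function)
    show "series.subspace ?V"
      by (auto simp: series.subspace_def series_scale_def)
  qed
  ultimately show "\<forall>w\<in>words. f w = f (Park w)"
    by (auto simp: PQSym_dual_def)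
next
  assume P: "\<forall>w\<in>words. f w = f (Park w)"
  obtain N where N: "\<And>w. f w \<noteq> 0 \<Longrightarrow> length w \<le> N"
    using assms by (auto simp: bounded_degree_def)
  let ?U = "{u. parking_function u \<and> length u \<le> N}"
  have sum_apply: "(\<Sum>u\<in>A. g u) w = (\<Sum>u\<in>A. g u w)"
    for A and g :: "nat list \<Rightarrow> nat list \<Rightarrow> 'k" and w
    by (induction A rule: infinite_finite_induct) auto
  have "f = (\<Sum>u\<in>?U. series_scale (f u) (G u))"
  proof
    fix w
    have "(\<Sum>u\<in>?U. series_scale (f u) (G u)) w =
        (\<Sum>u\<in>?U. if u = Park w then of_bool (w \<in> words) * f u else 0)"
      unfolding sum_apply by (rule sum.cong) (auto simp: series_scale_def G_apply)
    also have "\<dots> = (if Park w \<in> ?U then of_bool (w \<in> words) * f (Park w) else 0)"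
      using finite_parking_functions by (rule sum.delta)
    \<comment> \<open>If \<open>Park w\<close> is longer than \<open>N\<close> then so is
      \<open>w\<close>, because parkization keeps the length, and \<open>f w = 0\<close> by the
      choice of \<open>N\<close>.\<close>
    also have "\<dots> = f w"
    proof (cases "w \<in> words")
      case True
      then show ?thesis
        using P N[of w] parking_function_Park[OF True] by (auto simp: length_Park)
    next
      case False
      then show ?thesis
        using f by (simp add: word_series_def)
    qed
    finally show "f w = (\<Sum>u\<in>?U. series_scale (f u) (G u)) w" ..
  qed
  moreover have "(\<Sum>u\<in>?U. series_scale (f u) (G u)) \<in> PQSym_dual"
    unfolding PQSym_dual_def
    by (intro series.span_sum series.span_scale series.span_base) auto
  ultimately show "f \<in> PQSym_dual"
    by simp
qed

text \<open>An invariant series may involve words of unbounded length and is then an infinite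
  combination of the \<open>G u\<close>. Membership in the span is therefore characterized for
  bounded degree, membership in the completion for every series.\<close>

theorem mainTheorem2:
  shows "(\<forall>w\<in>words. Orb w = {w' \<in> words. Park w' = Park w}) \<and>
    (\<forall>u. parking_function u \<longrightarrow>
       (G u :: nat list \<Rightarrow> 'k::field_char_0) = formal_sum (Orb u)) \<and>
    (\<forall>f \<in> (word_series :: (nat list \<Rightarrow> 'k) set).
       (bounded_degree f \<longrightarrow> (f \<in> PQSym_dual \<longleftrightarrow> parking_invariant f)) \<and>
       (f \<in> PQSym_dual_completed \<longleftrightarrow> parking_invariant f))"
proof (intro conjI allI ballI impI)
  fix u :: "nat list" assume u: "parking_function u"
  then have "u \<in> words"
    by (simp add: parking_function_iff)
  then show "(G u :: nat list \<Rightarrow> 'k) = formal_sum (Orb u)"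
    by (simp add: Orb_eq_Park_class G_def Park_parking_function[OF u])
qed (simp_all add: Orb_eq_Park_class parking_invariant_iff PQSym_dual_iff PQSym_dual_completed_iff)

end
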